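(* For all integers $m$ and $n$ with $2\le m<n$, we have $20\le \tau_5(P_m\square P_n)\le 22$.
   Context: $P_n$ is the path on $n$ vertices and $P_m\square P_n$ is the $m\times n$ grid graph, where $\square$ denotes the Cartesian product of graphs. $[k]=\{1,\dots,k\}$ and $\binom{[k]}{t}$ is the collection of all $t$-element subsets of $[k]$. $d(v,w)$ is the distance between $v$ and $w$. For a finite simple graph $G$ and positive integers $t,k$, a $t$-tone $k$-coloring of $G$ is a function $f:V(G)\to\binom{[k]}{t}$ such that $|f(v)\cap f(w)|<d(v,w)$ for all distinct $v,w\in V(G)$. The $t$-tone chromatic number $\tau_t(G)$ is the minimum $k$ such that $G$ has a $t$-tone $k$-coloring. *)

theory Defs
  imports
    "Graph_Theory.Pair_Digraph"
    "Graph_Theory.Shortest_Path"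
    "HOL-Library.FuncSet"
begin

text \<open>
  A finite simple graph is an instance of the locale \<^locale>\<open>pair_graph\<close>: finitely many vertices,
  no loops, and an edge between \<open>u\<close> and \<open>v\<close> is present as both of the arcs \<open>(u, v)\<close>, \<open>(v, u)\<close>.
\<close>

definition path_graph :: "nat \<Rightarrow> nat pair_pre_digraph" where
  "path_graph n =
     \<lparr> pverts = {1..n},
       parcs = {(i, j). i \<in> {1..n} \<and> j \<in> {1..n} \<and> (j = Suc i \<or> i = Suc j)} \<rparr>"

definition cartesian_product ::
  "'a pair_pre_digraph \<Rightarrow> 'b pair_pre_digraph \<Rightarrow> ('a \<times> 'b) pair_pre_digraph"
  (infixr \<open>\<box>\<close> 80) where
  "G \<box> H =
     \<lparr> pverts = pverts G \<times> pverts H,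
       parcs = {((u, x), (v, y)).
         u = v \<and> u \<in> pverts G \<and> (x, y) \<in> parcs H \<or>
         x = y \<and> x \<in> pverts H \<and> (u, v) \<in> parcs G} \<rparr>"

lemma pair_graph_path_graph: "pair_graph (path_graph n)"
proof unfold_locales
  show "finite (parcs (path_graph n))"
    by (rule finite_subset[of _ "{1..n} \<times> {1..n}"]) (auto simp: path_graph_def)
qed (auto simp: path_graph_def symmetric_def sym_def)

lemma pair_graph_cartesian_product:
  assumes "pair_graph G" and "pair_graph H"
  shows "pair_graph (G \<box> H)"
proof -
  interpret G: pair_graph G by fact
  interpret H: pair_graph H by fact
  show ?thesis
  proof unfold_locales
    show "finite (parcs (G \<box> H))"
      by (rule finite_subset[of _ "(pverts G \<times> pverts H) \<times> (pverts G \<times> pverts H)"])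
        (auto simp: cartesian_product_def G.pair_finite_verts H.pair_finite_verts
          dest: G.wellformed' H.wellformed')
    show "symmetric (with_proj (G \<box> H))"
      using G.pair_sym_arcs H.pair_sym_arcs
      by (auto simp: symmetric_def sym_def cartesian_product_def)
  qed (auto simp: cartesian_product_def G.pair_finite_verts H.pair_finite_verts
      dest: G.wellformed' H.wellformed' G.pair_no_loops H.pair_no_loops)
qed

text \<open>
  The distance is the least number of arcs of a walk, that is, the shortest-path distance for
  unit arc weights; it is \<open>\<infinity>\<close> for vertices in different components.
\<close>

definition graph_dist :: "'a pair_pre_digraph \<Rightarrow> 'a \<Rightarrow> 'a \<Rightarrow> ereal" where
  "graph_dist G v w = wf_digraph.\<mu> (with_proj G) (\<lambda>_. 1) v w"

definition tone_coloring ::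
  "nat \<Rightarrow> nat \<Rightarrow> 'a pair_pre_digraph \<Rightarrow> ('a \<Rightarrow> nat set) \<Rightarrow> bool" where
  "tone_coloring t k G f \<longleftrightarrow>
     f \<in> pverts G \<rightarrow> {A. A \<subseteq> {1..k} \<and> card A = t} \<and>
     (\<forall>v\<in>pverts G. \<forall>w\<in>pverts G. v \<noteq> w \<longrightarrow>
        ereal (real (card (f v \<inter> f w))) < graph_dist G v w)"

definition tone_chromatic_number :: "nat \<Rightarrow> 'a pair_pre_digraph \<Rightarrow> nat" (\<open>\<tau>\<^bsub>_\<^esub>\<close>) where
  "\<tau>\<^bsub>t\<^esub> G = (LEAST k. 0 < k \<and> (\<exists>f. tone_coloring t k G f))"

lemma graph_dist_eq_INF:
  assumes "pair_graph G"
  shows "graph_dist G v w =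
    (INF p\<in>{p. pre_digraph.awalk (with_proj G) v p w}. ereal (real (length p)))"
proof -
  interpret pair_graph G by fact
  show ?thesis
    by (simp add: graph_dist_def \<mu>_def awalk_cost_def sum_list_triv)
qed

text \<open>The minimum defining \<^const>\<open>tone_chromatic_number\<close> is taken over a nonempty set.\<close>

lemma tone_coloring_exists:
  assumes "pair_graph G"
  shows "\<exists>k f. 0 < k \<and> tone_coloring t k G f"
proof -
  interpret pair_graph G by fact
  obtain h where h: "bij_betw h (pverts G) {0..<card (pverts G)}"
    using ex_bij_betw_finite_nat[OF pair_finite_verts] by blast
  define f where "f v = {h v * t + 1..h v * t + t}" for v
  define k where "k = card (pverts G) * t + 1"
  have le: "h v * t + t \<le> k" if "v \<in> pverts G" for v
  proof -
    have "Suc (h v) \<le> card (pverts G)"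
      using bij_betwE[OF h] that by auto
    then have "Suc (h v) * t \<le> card (pverts G) * t" by (rule mult_le_mono1)
    then show ?thesis by (simp add: k_def)
  qed
  have disj: "f v \<inter> f w = {}" if "h v < h w" for v w
  proof -
    have "Suc (h v) * t \<le> h w * t" using that by (intro mult_le_mono1) simp
    then show ?thesis by (auto simp: f_def)
  qed
  have pos: "0 < graph_dist G v w" if "v \<noteq> w" for v w
  proof -
    have "1 \<le> graph_dist G v w"
      unfolding graph_dist_eq_INF[OF assms]
    proof (rule INF_greatest)
      fix p assume "p \<in> {p. awalk v p w}"
      with that have "p \<noteq> []" by (auto simp: awalk_def)
      then have "1 \<le> real (length p)" by (cases p) auto
      then show "1 \<le> ereal (real (length p))" by (simp add: one_ereal_def)
    qed
    then show ?thesis by (rule less_le_trans[rotated]) simp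
  qed
  have "tone_coloring t k G f"
    unfolding tone_coloring_def
  proof (intro conjI ballI impI)
    show "f \<in> pverts G \<rightarrow> {A. A \<subseteq> {1..k} \<and> card A = t}"
      using le by (force simp: f_def)
  next
    fix v w assume vw: "v \<in> pverts G" "w \<in> pverts G" "v \<noteq> w"
    then have "h v \<noteq> h w" using h by (auto simp: bij_betw_def inj_on_def)
    then have "f v \<inter> f w = {}" using disj[of v w] disj[of w v] by (auto simp: neq_iff)
    then show "ereal (real (card (f v \<inter> f w))) < graph_dist G v w"
      using pos[OF vw(3)] by (simp add: zero_ereal_def)
  qed
  moreover have "0 < k" by (simp add: k_def)
  ultimately show ?thesis by blast
qed

end

theory Submission
  imports Defs
begin

text \<open>
  In a grid the graph distance is the taxicab distance, so a \<open>t\<close>-tone colouring of a grid is an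
  assignment of \<open>t\<close>-sets to its points in which two points at taxicab distance \<open>d\<close> share fewer
  than \<open>d\<close> colours.

  Lower bound: the grid contains a \<open>2 \<times> 3\<close> block. Among its six points, adjacent ones
  share no colour, the six pairs at distance \<open>2\<close> share at most one colour each, and the two pairs at
  distance \<open>3\<close> share at most two each. By Bonferroni's inequality (\<open>bonferroni_lower\<close>) the
  six \<open>5\<close>-sets cover at least \<open>6 \<cdot> 5 - (6 \<cdot> 1 + 2 \<cdot> 2) = 20\<close> colours.

  Upper bound: \<open>21\<close> colours are enough. Identify the colours with the residues modulo
  \<open>21\<close> and give the point \<open>(i, j)\<close> the translate of \<open>S = {0, 2, 5, 9, 13}\<close> by \<open>i + 6j\<close>. The number of
  colours shared by two points then depends only on their difference \<open>(a, b)\<close>: it is the number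
  of elements that \<open>S\<close> has in common with its translate by \<open>a + 6b\<close>. As this is at most \<open>5\<close>, only the
  finitely many differences with \<open>\<bar>a\<bar> + \<bar>b\<bar> \<le> 5\<close> have to be checked (\<open>tone_base_check\<close>).
\<close>

section \<open>Distance in grids\<close>

text \<open>The \<open>\<ell>\<^sub>1\<close> distance of two points of the integer lattice. The coordinates are compared as
  integers, since subtraction of natural numbers truncates.\<close>

definition taxicab :: "nat \<times> nat \<Rightarrow> nat \<times> nat \<Rightarrow> nat" where
  "taxicab v w = nat \<bar>int (fst v) - int (fst w)\<bar> + nat \<bar>int (snd v) - int (snd w)\<bar>"

abbreviation grid :: "nat \<Rightarrow> nat \<Rightarrow> (nat \<times> nat) pair_pre_digraph" where
  "grid m n \<equiv> path_graph m \<box> path_graph n"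

lemma pair_graph_grid: "pair_graph (grid m n)"
  by (intro pair_graph_cartesian_product pair_graph_path_graph)

lemma pverts_grid: "pverts (grid m n) = {1..m} \<times> {1..n}"
  by (simp add: cartesian_product_def path_graph_def)

lemma parcs_grid_iff:
  "(v, w) \<in> parcs (grid m n) \<longleftrightarrow>
     v \<in> {1..m} \<times> {1..n} \<and> w \<in> {1..m} \<times> {1..n} \<and> taxicab v w = 1"
  by (cases v; cases w) (auto simp: cartesian_product_def path_graph_def taxicab_def)

lemma taxicab_triangle: "taxicab u w \<le> taxicab u v + taxicab v w"
proof -
  have tri: "nat \<bar>a - c\<bar> \<le> nat \<bar>a - b\<bar> + nat \<bar>b - c\<bar>" for a c b :: int by linarith
  show ?thesis
    unfolding taxicab_def
    by (rule order_trans[OF add_mono[OF tri[of _ _ "int (fst v)"] tri[of _ _ "int (snd v)"]]]) simp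
qed

lemma awalk_grid_taxicab_le:
  assumes "pre_digraph.awalk (with_proj (grid m n)) v p w"
  shows "taxicab v w \<le> length p"
proof -
  interpret pair_graph "grid m n" by (rule pair_graph_grid)
  show ?thesis
    using assms
  proof (induction p arbitrary: v)
    case Nil
    then show ?case by (simp add: awalk_def taxicab_def)
  next
    case (Cons e p)
    obtain x u where e: "e = (x, u)" by (cases e)
    have "x = v" "(v, u) \<in> parcs (grid m n)" "awalk u p w"
      using Cons.prems by (auto simp: e awalk_Cons_iff)
    then show ?case
      using Cons.IH[of u] taxicab_triangle[of v w u] by (simp add: parcs_grid_iff)
  qed
qed

lemma grid_step_towards:
  assumes "v \<in> {1..m} \<times> {1..n}" "w \<in> {1..m} \<times> {1..n}" "taxicab v w = Suc d"
  obtains u where "(v, u) \<in> parcs (grid m n)" "taxicab u w = d"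
proof -
  obtain i j i' j' where vw: "v = (i, j)" "w = (i', j')" by (cases v; cases w)
  consider "i < i'" | "i > i'" | "j < j'" | "j > j'"
    using assms(3) by (force simp: vw taxicab_def)
  then show ?thesis
  proof cases
    case 1
    then show ?thesis using assms by (intro that[of "(i + 1, j)"]) (auto simp: vw parcs_grid_iff taxicab_def)
  next
    case 2
    then show ?thesis using assms by (intro that[of "(i - 1, j)"]) (auto simp: vw parcs_grid_iff taxicab_def)
  next
    case 3
    then show ?thesis using assms by (intro that[of "(i, j + 1)"]) (auto simp: vw parcs_grid_iff taxicab_def)
  next
    case 4
    then show ?thesis using assms by (intro that[of "(i, j - 1)"]) (auto simp: vw parcs_grid_iff taxicab_def)
  qed
qed

lemma grid_geodesic_exists:
  assumes "v \<in> {1..m} \<times> {1..n}" "w \<in> {1..m} \<times> {1..n}"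
  shows "\<exists>p. pre_digraph.awalk (with_proj (grid m n)) v p w \<and> length p = taxicab v w"
proof -
  interpret pair_graph "grid m n" by (rule pair_graph_grid)
  show ?thesis
    using assms
  proof (induction "taxicab v w" arbitrary: v)
    case 0
    then have "v = w" by (auto simp: taxicab_def prod_eq_iff)
    then have "awalk v [] w" using "0.prems" by (simp add: awalk_Nil_iff pverts_grid)
    then show ?case using "0.hyps" by (intro exI[of _ "[]"]) simp
  next
    case (Suc d)
    obtain u where u: "(v, u) \<in> parcs (grid m n)" "taxicab u w = d"
      using grid_step_towards[OF Suc.prems Suc.hyps(2)[symmetric]] by blast
    then obtain p where p: "awalk u p w" "length p = d"
      using Suc.hyps(1)[of u] Suc.prems(2) by (auto simp: parcs_grid_iff)
    have "awalk v ((v, u) # p) w" using u p by (simp add: awalk_Cons_iff)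
    then show ?case using p Suc.hyps(2) by (intro exI[of _ "(v, u) # p"]) simp
  qed
qed

lemma graph_dist_grid:
  assumes "v \<in> {1..m} \<times> {1..n}" "w \<in> {1..m} \<times> {1..n}"
  shows "graph_dist (grid m n) v w = ereal (real (taxicab v w))"
  unfolding graph_dist_eq_INF[OF pair_graph_grid]
proof (rule antisym)
  obtain p where p: "pre_digraph.awalk (with_proj (grid m n)) v p w" "length p = taxicab v w"
    using grid_geodesic_exists[OF assms] by blast
  show "(INF p\<in>{p. pre_digraph.awalk (with_proj (grid m n)) v p w}. ereal (real (length p)))
      \<le> ereal (real (taxicab v w))"
    using p by (intro INF_lower2[of p]) auto
  show "ereal (real (taxicab v w))
      \<le> (INF p\<in>{p. pre_digraph.awalk (with_proj (grid m n)) v p w}. ereal (real (length p)))"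
    by (intro INF_greatest) (simp add: awalk_grid_taxicab_le)
qed

lemma tone_coloring_grid_iff:
  "tone_coloring t k (grid m n) f \<longleftrightarrow>
     (\<forall>v\<in>{1..m} \<times> {1..n}. f v \<subseteq> {1..k} \<and> card (f v) = t) \<and>
     (\<forall>v\<in>{1..m} \<times> {1..n}. \<forall>w\<in>{1..m} \<times> {1..n}. v \<noteq> w \<longrightarrow>
        card (f v \<inter> f w) < taxicab v w)"
  unfolding tone_coloring_def pverts_grid
  by (intro conj_cong ball_cong refl) (auto simp: Pi_iff graph_dist_grid)

section \<open>The lower bound\<close>

lemma bonferroni_lower:
  fixes A :: "nat \<Rightarrow> 'a set"
  assumes "\<And>j. j < k \<Longrightarrow> finite (A j)"
  shows "(\<Sum>j<k. card (A j)) \<le> card (\<Union>j<k. A j) + (\<Sum>j<k. \<Sum>i<j. card (A i \<inter> A j))"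
  using assms
proof (induction k)
  case 0
  then show ?case by simp
next
  case (Suc k)
  let ?U = "\<Union>j<k. A j"
  have fin: "finite ?U" "finite (A k)" using Suc.prems by auto
  have "?U \<inter> A k = (\<Union>i<k. A i \<inter> A k)" by blast
  then have "card (?U \<inter> A k) \<le> (\<Sum>i<k. card (A i \<inter> A k))"
    by (metis card_UN_le finite_lessThan)
  moreover have "card ?U + card (A k) = card (?U \<union> A k) + card (?U \<inter> A k)"
    by (rule card_Un_Int[OF fin])
  moreover have "(\<Union>j<Suc k. A j) = ?U \<union> A k" by (auto simp: less_Suc_eq)
  ultimately show ?case using Suc by simp
qed

lemma five_tone_grid_ge_20:
  assumes "2 \<le> m" "3 \<le> n" and f: "tone_coloring 5 k (grid m n) f"
  shows "20 \<le> k"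
proof -
  define B :: "(nat \<times> nat) list" where
    "B = [(1, 1), (2, 1), (1, 2), (2, 2), (1, 3), (2, 3)]"
  define A where "A j = f (B ! j)" for j
  have B: "B ! j \<in> {1..m} \<times> {1..n}" if "j < 6" for j
  proof -
    have "set B \<subseteq> {1..m} \<times> {1..n}" using assms by (auto simp: B_def)
    then show ?thesis using that nth_mem[of j B] by (auto simp: B_def)
  qed
  have A: "A j \<subseteq> {1..k}" "card (A j) = 5" if "j < 6" for j
    using f[unfolded tone_coloring_grid_iff, THEN conjunct1, rule_format, OF B[OF that]]
    by (simp_all add: A_def)
  have "distinct B" "length B = 6" by (auto simp: B_def)
  then have pair: "card (A i \<inter> A j) \<le> taxicab (B ! i) (B ! j) - 1" if "i < j" "j < 6" for i j
  proof -
    have "B ! i \<noteq> B ! j" using that \<open>distinct B\<close> \<open>length B = 6\<close> by (simp add: nth_eq_iff_index_eq)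
    then have "card (A i \<inter> A j) < taxicab (B ! i) (B ! j)"
      unfolding A_def using that
      by (intro f[unfolded tone_coloring_grid_iff, THEN conjunct2, rule_format] B) auto
    then show ?thesis by simp
  qed
  \<comment> \<open>Six pairs of the block are at distance \<open>2\<close>, two at distance \<open>3\<close>, and the rest are adjacent.\<close>
  have "(\<Sum>j<6. \<Sum>i<j. card (A i \<inter> A j))
      \<le> (\<Sum>j<6. \<Sum>i<j. taxicab (B ! i) (B ! j) - 1)"
    by (intro sum_mono pair) auto
  also have "\<dots> = 10"
    by (simp add: numeral_eq_Suc B_def taxicab_def)
  finally have pairs: "(\<Sum>j<6. \<Sum>i<j. card (A i \<inter> A j)) \<le> 10" .
  have "30 = (\<Sum>j<6. card (A j))" using A(2) by simp
  also have "\<dots> \<le> card (\<Union>j<6. A j) + (\<Sum>j<6. \<Sum>i<j. card (A i \<inter> A j))"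
    using A(1) by (intro bonferroni_lower) (auto intro: finite_subset)
  also have "card (\<Union>j<6. A j) \<le> card {1..k}"
    using A(1) by (intro card_mono) auto
  finally show ?thesis using pairs by simp
qed

section \<open>A colouring with 21 colours\<close>

text \<open>The base set of the colouring. Its \<open>20\<close> differences modulo \<open>21\<close> avoid \<open>\<plusminus>1\<close> and \<open>\<plusminus>6\<close>, by which the
  translation amounts of adjacent points differ, and hit each of \<open>\<plusminus>2\<close>, \<open>\<plusminus>5\<close>, \<open>\<plusminus>7\<close>, \<open>\<plusminus>9\<close>, which belong
  to points at distance \<open>2\<close>, only once.\<close>

definition tone_base :: "int set" where
  "tone_base = {0, 2, 5, 9, 13}"

text \<open>The translate of the base set by \<open>x\<close> modulo \<open>21\<close>, with the residues \<open>0, \<dots>, 20\<close> renamed to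
  the colours \<open>1, \<dots>, 21\<close>.\<close>

definition base_translate :: "int \<Rightarrow> nat set" where
  "base_translate x = (\<lambda>s. Suc (nat ((s + x) mod 21))) ` tone_base"

lemma base_translate_subset: "base_translate x \<subseteq> {1..21}"
proof -
  have "Suc (nat (y mod 21)) \<in> {1..21}" for y :: int
    using pos_mod_bound[of 21 y] pos_mod_sign[of 21 y] by simp
  then show ?thesis by (auto simp: base_translate_def)
qed

lemma tone_base_mod: "s \<in> tone_base \<Longrightarrow> s mod 21 = s"
  by (auto simp: tone_base_def)

lemma card_base_translate: "card (base_translate x) = 5"
proof -
  have "inj_on (\<lambda>s. Suc (nat ((s + x) mod 21))) tone_base"
  proof (rule inj_onI)
    fix s s' assume s: "s \<in> tone_base" "s' \<in> tone_base"
      and "Suc (nat ((s + x) mod 21)) = Suc (nat ((s' + x) mod 21))"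
    then have "(s + x) mod 21 = (s' + x) mod 21" by (simp add: eq_nat_nat_iff)
    then have "(s + x - x) mod 21 = (s' + x - x) mod 21" by (rule mod_diff_cong) simp
    then show "s = s'" using s by (simp add: tone_base_mod)
  qed
  then show ?thesis by (simp add: base_translate_def card_image) (simp add: tone_base_def)
qed

lemma card_base_translate_Int_le:
  "card (base_translate x \<inter> base_translate y)
     \<le> card ((\<lambda>s. (s + (x - y)) mod 21) ` tone_base \<inter> tone_base)"
    (is "_ \<le> card ?F")
proof -
  have "base_translate x \<inter> base_translate y \<subseteq> (\<lambda>s. Suc (nat ((s + y) mod 21))) ` ?F"
  proof
    fix c assume "c \<in> base_translate x \<inter> base_translate y"
    then obtain s s' where s: "s \<in> tone_base" "s' \<in> tone_base"
      and c: "c = Suc (nat ((s + x) mod 21))" "c = Suc (nat ((s' + y) mod 21))"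
      by (auto simp: base_translate_def)
    then have "(s + x) mod 21 = (s' + y) mod 21" by (simp add: eq_nat_nat_iff)
    then have "(s + x - y) mod 21 = (s' + y - y) mod 21" by (rule mod_diff_cong) simp
    then have "(s + (x - y)) mod 21 = s'" using s by (simp add: tone_base_mod algebra_simps)
    then have "s' \<in> ?F" using s by auto
    then show "c \<in> (\<lambda>s. Suc (nat ((s + y) mod 21))) ` ?F" using c by blast
  qed
  moreover have "finite ?F" by (simp add: tone_base_def)
  ultimately show ?thesis by (meson card_image_le card_mono finite_imageI le_trans)
qed

text \<open>Among the nonzero differences \<open>(a, b)\<close>, those with \<open>a + 6b\<close> divisible by \<open>21\<close>, where
  the base set is translated to itself, satisfy \<open>\<bar>a\<bar> + \<bar>b\<bar> \<ge> 6\<close>; equality holds for \<open>\<plusminus>(3, 3)\<close>.\<close>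

lemma tone_base_check:
  "\<forall>a\<in>set [-5..5]. \<forall>b\<in>set [-5..5]. (a, b) \<noteq> (0, 0) \<longrightarrow>
     int (card ((\<lambda>s. (s + (a + 6 * b)) mod 21) ` tone_base \<inter> tone_base)) < \<bar>a\<bar> + \<bar>b\<bar>"
  by (simp add: tone_base_def upto.simps)

lemma five_tone_grid_21:
  "tone_coloring 5 21 (grid m n) (\<lambda>(i, j). base_translate (int i + 6 * int j))"
  unfolding tone_coloring_grid_iff
proof (intro conjI ballI impI)
  fix v w :: "nat \<times> nat"
  assume "v \<noteq> w"
  obtain i j i' j' where vw: "v = (i, j)" "w = (i', j')" by (cases v; cases w)
  define a b where "a = int i - int i'" and "b = int j - int j'"
  have d: "int (taxicab v w) = \<bar>a\<bar> + \<bar>b\<bar>" by (simp add: vw taxicab_def a_def b_def)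
  have ab: "(a, b) \<noteq> (0, 0)" using \<open>v \<noteq> w\<close> by (auto simp: vw a_def b_def)
  let ?I = "base_translate (int i + 6 * int j) \<inter> base_translate (int i' + 6 * int j')"
  let ?F = "(\<lambda>s. (s + (a + 6 * b)) mod 21) ` tone_base \<inter> tone_base"
  have "(int i + 6 * int j) - (int i' + 6 * int j') = a + 6 * b" by (simp add: a_def b_def)
  then have le: "card ?I \<le> card ?F" by (metis card_base_translate_Int_le)
  have "int (card ?F) < \<bar>a\<bar> + \<bar>b\<bar>"
  proof (cases "\<bar>a\<bar> + \<bar>b\<bar> \<le> 5")
    case True
    then have "a \<in> set [-5..5]" "b \<in> set [-5..5]" by auto
    then show ?thesis using tone_base_check ab by blast
  next
    case False
    have "card ?F \<le> card tone_base" by (rule card_mono) (auto simp: tone_base_def)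
    also have "\<dots> = 5" by (simp add: tone_base_def)
    finally show ?thesis using False by simp
  qed
  then show "card ((case v of (i, j) \<Rightarrow> base_translate (int i + 6 * int j)) \<inter>
      (case w of (i, j) \<Rightarrow> base_translate (int i + 6 * int j))) < taxicab v w"
    using le d by (simp add: vw)
qed (use base_translate_subset card_base_translate in auto)

section \<open>The two bounds\<close>

theorem theorem5p3:
  fixes m n :: nat
  assumes "2 \<le> m" and "m < n"
  shows "20 \<le> \<tau>\<^bsub>5\<^esub> (path_graph m \<box> path_graph n) \<and>
         \<tau>\<^bsub>5\<^esub> (path_graph m \<box> path_graph n) \<le> 22"
proof
  let ?P = "\<lambda>k. 0 < k \<and> (\<exists>f. tone_coloring 5 k (grid m n) f)"
  have "?P (\<tau>\<^bsub>5\<^esub> (grid m n))"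
    unfolding tone_chromatic_number_def
    by (rule LeastI_ex) (use tone_coloring_exists[OF pair_graph_grid] in blast)
  then show "20 \<le> \<tau>\<^bsub>5\<^esub> (grid m n)"
    using five_tone_grid_ge_20[of m n] assms by auto
  have "\<tau>\<^bsub>5\<^esub> (grid m n) \<le> 21"
    unfolding tone_chromatic_number_def
    by (rule Least_le) (use five_tone_grid_21 in auto)
  then show "\<tau>\<^bsub>5\<^esub> (grid m n) \<le> 22" by simp
qed

end
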